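(* Let $\Lambda$ be a basic finite dimensional algebra over a field $k$ with one-dimensional simple modules, and let $K$ be an ideal of $\Lambda$ contained in $J(\Lambda)^2$. Then the natural algebra epimorphism $\Lambda\to\Lambda/K$ does not split, i.e. there is no $k$-algebra homomorphism $\iota:\Lambda/K\to\Lambda$ whose composition with the natural epimorphism is the identity of $\Lambda/K$.
   Context: $J(\Lambda)$ denotes the Jacobson radical of $\Lambda$. Ideals are two-sided. Algebra homomorphisms are unital and $k$-linear.
   Formalization: The ideal K is additionally assumed to be nonzero; for K = 0 the natural epimorphism is an isomorphism and does split, so the claim as stated fails there. *)

theory Defs
  imports "HOL-Algebra.QuotRing" "HOL-Algebra.Ideal_Product"
    "Jordan_Normal_Form.Missing_VectorSpace"
begin

section \<open>Algebras over a field\<close>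

text \<open>The locale \<open>algebra\<close> of HOL-Algebra is restricted to commutative algebras.\<close>

locale assoc_algebra = vectorspace k A + A?: ring A for k and A (structure) +
  assumes smult_mult_left:
      "\<lbrakk>c \<in> carrier k; x \<in> carrier A; y \<in> carrier A\<rbrakk> \<Longrightarrow>
        (c \<odot>\<^bsub>A\<^esub> x) \<otimes>\<^bsub>A\<^esub> y = c \<odot>\<^bsub>A\<^esub> (x \<otimes>\<^bsub>A\<^esub> y)"
    and smult_mult_right:
      "\<lbrakk>c \<in> carrier k; x \<in> carrier A; y \<in> carrier A\<rbrakk> \<Longrightarrow>
        x \<otimes>\<^bsub>A\<^esub> (c \<odot>\<^bsub>A\<^esub> y) = c \<odot>\<^bsub>A\<^esub> (x \<otimes>\<^bsub>A\<^esub> y)"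

definition alg_hom ::
  "('c, 'd) ring_scheme \<Rightarrow> ('c, 'a, 'm) module_scheme \<Rightarrow> ('c, 'b, 'n) module_scheme \<Rightarrow> ('a \<Rightarrow> 'b) set"
  where "alg_hom k A B =
    {h \<in> ring_hom A B. \<forall>c\<in>carrier k. \<forall>x\<in>carrier A. h (c \<odot>\<^bsub>A\<^esub> x) = c \<odot>\<^bsub>B\<^esub> h x}"

text \<open>The ring \<open>A Quot I\<close> with the induced scalar multiplication, which is defined on cosets
  in the same style as \<^const>\<open>rcoset_mult\<close>.\<close>

definition quot_algebra ::
  "('c, 'a, 'm) module_scheme \<Rightarrow> 'a set \<Rightarrow> ('c, 'a set) module"
  where "quot_algebra A I =
    \<lparr>carrier = carrier (A Quot I), mult = mult (A Quot I), one = one (A Quot I),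
     zero = zero (A Quot I), add = add (A Quot I),
     smult = (\<lambda>c X. \<Union>x\<in>X. I +>\<^bsub>A\<^esub> (c \<odot>\<^bsub>A\<^esub> x))\<rparr>"


section \<open>Left modules over a ring\<close>

text \<open>The locale \<open>module\<close> of HOL-Algebra is restricted to commutative ground rings;
  the axioms below are the same.\<close>

locale left_module = R?: ring R + M?: abelian_group M
  for R :: "('a, 'b) ring_scheme" (structure) and M :: "('a, 'v, 'm) module_scheme" (structure) +
  assumes lsmult_closed [simp, intro]:
      "\<lbrakk>a \<in> carrier R; x \<in> carrier M\<rbrakk> \<Longrightarrow> a \<odot>\<^bsub>M\<^esub> x \<in> carrier M"
    and lsmult_l_distr:
      "\<lbrakk>a \<in> carrier R; b \<in> carrier R; x \<in> carrier M\<rbrakk> \<Longrightarrow>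
        (a \<oplus> b) \<odot>\<^bsub>M\<^esub> x = a \<odot>\<^bsub>M\<^esub> x \<oplus>\<^bsub>M\<^esub> b \<odot>\<^bsub>M\<^esub> x"
    and lsmult_r_distr:
      "\<lbrakk>a \<in> carrier R; x \<in> carrier M; y \<in> carrier M\<rbrakk> \<Longrightarrow>
        a \<odot>\<^bsub>M\<^esub> (x \<oplus>\<^bsub>M\<^esub> y) = a \<odot>\<^bsub>M\<^esub> x \<oplus>\<^bsub>M\<^esub> a \<odot>\<^bsub>M\<^esub> y"
    and lsmult_assoc1:
      "\<lbrakk>a \<in> carrier R; b \<in> carrier R; x \<in> carrier M\<rbrakk> \<Longrightarrow>
        (a \<otimes> b) \<odot>\<^bsub>M\<^esub> x = a \<odot>\<^bsub>M\<^esub> (b \<odot>\<^bsub>M\<^esub> x)"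
    and lsmult_one [simp]:
      "x \<in> carrier M \<Longrightarrow> \<one> \<odot>\<^bsub>M\<^esub> x = x"

text \<open>\<open>Module.submodule\<close> (the HOL-Algebra locale, as opposed to the one of the AFP entry
  VectorSpace) does not presuppose a commutative ground ring.\<close>

definition simple_left_module ::
  "('a, 'b) ring_scheme \<Rightarrow> ('a, 'v, 'm) module_scheme \<Rightarrow> bool"
  where "simple_left_module R M \<longleftrightarrow> left_module R M \<and> carrier M \<noteq> {\<zero>\<^bsub>M\<^esub>} \<and>
    (\<forall>N. Module.submodule N R M \<longrightarrow> N = {\<zero>\<^bsub>M\<^esub>} \<or> N = carrier M)"

definition left_module_iso ::
  "('a, 'b) ring_scheme \<Rightarrow> ('a, 'v, 'm) module_scheme \<Rightarrow> ('a, 'w, 'n) module_scheme \<Rightarrow> bool"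
  where "left_module_iso R M N \<longleftrightarrow>
    (\<exists>f\<in>module_hom R M N. bij_betw f (carrier M) (carrier N))"

definition left_regular :: "('a, 'b) ring_scheme \<Rightarrow> ('a, 'a) module"
  where "left_regular R =
    \<lparr>carrier = carrier R, mult = mult R, one = one R, zero = zero R, add = add R,
     smult = mult R\<rparr>"

text \<open>A module \<open>M\<close> over the \<open>k\<close>-algebra \<open>A\<close>, regarded as a \<open>k\<close>-vector space through
  \<open>k \<rightarrow> A\<close>. (The ring fields \<open>mult\<close> and \<open>one\<close> of a module record carry no information.)\<close>

definition restrict_scalars ::
  "('c, 'a, 'm) module_scheme \<Rightarrow> ('a, 'v, 'n) module_scheme \<Rightarrow> ('c, 'v) module"
  where "restrict_scalars A M =
    \<lparr>carrier = carrier M, mult = mult M, one = one M, zero = zero M, add = add M,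
     smult = (\<lambda>c x. (c \<odot>\<^bsub>A\<^esub> \<one>\<^bsub>A\<^esub>) \<odot>\<^bsub>M\<^esub> x)\<rparr>"

text \<open>The carrier type of the simple modules is fixed to \<open>'a set\<close>, where \<open>'a\<close> is the type of the
  elements of \<open>A\<close>, because HOL cannot quantify over types here. No simple module is lost: a
  simple module is a quotient of the regular one, so up to isomorphism its elements are cosets;
  see \<open>simple_left_module_universe\<close> below. The conjunct \<open>fin_dim\<close> is needed since
  \<open>vectorspace.dim\<close> is meaningful for finite dimensional spaces only.\<close>

definition one_dimensional_simples ::
  "('c, 'd) ring_scheme \<Rightarrow> ('c, 'a, 'm) module_scheme \<Rightarrow> bool"
  where "one_dimensional_simples k A \<longleftrightarrow>
    (\<forall>M :: ('a, 'a set) module. simple_left_module A M \<longrightarrow>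
      vectorspace.fin_dim k (restrict_scalars A M) \<and>
      vectorspace.dim k (restrict_scalars A M) = 1)"


section \<open>The Jacobson radical\<close>

abbreviation left_ideal :: "'a set \<Rightarrow> ('a, 'b) ring_scheme \<Rightarrow> bool"
  where "left_ideal I R \<equiv> Module.submodule I R (left_regular R)"

definition maximal_left_ideal :: "'a set \<Rightarrow> ('a, 'b) ring_scheme \<Rightarrow> bool"
  where "maximal_left_ideal I R \<longleftrightarrow> left_ideal I R \<and> I \<noteq> carrier R \<and>
    (\<forall>J. left_ideal J R \<and> I \<subseteq> J \<longrightarrow> J = I \<or> J = carrier R)"

definition jacobson_radical :: "('a, 'b) ring_scheme \<Rightarrow> 'a set"
  where "jacobson_radical R = carrier R \<inter> \<Inter>{I. maximal_left_ideal I R}"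


section \<open>Basic algebras\<close>

definition primitive_idempotent :: "('a, 'b) ring_scheme \<Rightarrow> 'a \<Rightarrow> bool"
  where "primitive_idempotent R e \<longleftrightarrow> e \<in> carrier R \<and> e \<otimes>\<^bsub>R\<^esub> e = e \<and> e \<noteq> \<zero>\<^bsub>R\<^esub> \<and>
    (\<forall>f\<in>carrier R. \<forall>g\<in>carrier R.
      f \<otimes>\<^bsub>R\<^esub> f = f \<and> g \<otimes>\<^bsub>R\<^esub> g = g \<and> f \<otimes>\<^bsub>R\<^esub> g = \<zero>\<^bsub>R\<^esub> \<and> g \<otimes>\<^bsub>R\<^esub> f = \<zero>\<^bsub>R\<^esub> \<and> e = f \<oplus>\<^bsub>R\<^esub> g
      \<longrightarrow> f = \<zero>\<^bsub>R\<^esub> \<or> g = \<zero>\<^bsub>R\<^esub>)"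

definition complete_primitive_orthogonal_idempotents ::
  "('a, 'b) ring_scheme \<Rightarrow> 'a set \<Rightarrow> bool"
  where "complete_primitive_orthogonal_idempotents R E \<longleftrightarrow>
    finite E \<and> (\<forall>e\<in>E. primitive_idempotent R e) \<and>
    (\<forall>e\<in>E. \<forall>f\<in>E. e \<noteq> f \<longrightarrow> e \<otimes>\<^bsub>R\<^esub> f = \<zero>\<^bsub>R\<^esub>) \<and>
    finsum R (\<lambda>e. e) E = \<one>\<^bsub>R\<^esub>"

text \<open>The left module \<open>R e\<close>.\<close>

definition principal_left_module :: "('a, 'b) ring_scheme \<Rightarrow> 'a \<Rightarrow> ('a, 'a) module"
  where "principal_left_module R e =
    (left_regular R)\<lparr>carrier := (\<lambda>x. x \<otimes>\<^bsub>R\<^esub> e) ` carrier R\<rparr>"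

text \<open>The regular module is a direct sum of pairwise non-isomorphic indecomposable projectives
  \<open>R e\<close>. By the Krull-Schmidt theorem the choice of the complete set of idempotents of a finite
  dimensional algebra is irrelevant.\<close>

definition basic_algebra :: "('a, 'b) ring_scheme \<Rightarrow> bool"
  where "basic_algebra R \<longleftrightarrow> (\<exists>E. complete_primitive_orthogonal_idempotents R E \<and>
    (\<forall>e\<in>E. \<forall>f\<in>E. e \<noteq> f \<longrightarrow>
      \<not> left_module_iso R (principal_left_module R e) (principal_left_module R f)))"


section \<open>Consistency of the encodings\<close>

lemma (in ring) left_regular_left_module: "left_module R (left_regular R)"
proof -
  have "abelian_group (left_regular R)"
    by (rule abelian_groupI)
      (auto simp: left_regular_def a_ac intro: a_inv_closed l_neg bexI[of _ "\<ominus> _"])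
  then show ?thesis
    by (intro left_module.intro left_module_axioms.intro ring_axioms)
      (auto simp: left_regular_def l_distr r_distr m_assoc)
qed

lemma (in assoc_algebra) restrict_scalars_vectorspace:
  assumes "left_module A M"
  shows "vectorspace k (restrict_scalars A M)"
proof -
  interpret M: left_module A M by fact
  have "abelian_group (restrict_scalars A M)"
    by (rule abelian_groupI)
      (auto simp: restrict_scalars_def M.M.a_ac intro!: bexI[of _ "\<ominus>\<^bsub>M\<^esub> _"] M.M.l_neg)
  moreover have "(c \<odot>\<^bsub>A\<^esub> \<one>) \<otimes> (d \<odot>\<^bsub>A\<^esub> \<one>) = (c \<otimes>\<^bsub>k\<^esub> d) \<odot>\<^bsub>A\<^esub> \<one>"
    if "c \<in> carrier k" "d \<in> carrier k" for c d
    using that by (simp add: smult_mult_left smult_assoc1)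
  ultimately have "module k (restrict_scalars A M)"
    by (intro module.intro module_axioms.intro module.R.cring_axioms)
      (auto simp: restrict_scalars_def smult_l_distr M.lsmult_l_distr M.lsmult_r_distr
        simp flip: M.lsmult_assoc1)
  then show ?thesis
    by (intro vectorspace.intro field_axioms)
qed

lemma (in assoc_algebra) smult_ideal:
  assumes "ideal I A" "c \<in> carrier k" "x \<in> I"
  shows "c \<odot>\<^bsub>A\<^esub> x \<in> I"
proof -
  interpret I: ideal I A by fact
  have "c \<odot>\<^bsub>A\<^esub> x = (c \<odot>\<^bsub>A\<^esub> \<one>) \<otimes> x"
    using assms I.Icarr by (simp add: smult_mult_left)
  then show ?thesis
    using assms I.I_l_closed by simp
qed

lemma (in assoc_algebra) quot_algebra_smult:
  assumes "ideal I A" "c \<in> carrier k" "x \<in> carrier A"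
  shows "c \<odot>\<^bsub>quot_algebra A I\<^esub> (I +> x) = I +> (c \<odot>\<^bsub>A\<^esub> x)"
proof -
  interpret I: ideal I A by fact
  have "I +> (c \<odot>\<^bsub>A\<^esub> y) = I +> (c \<odot>\<^bsub>A\<^esub> x)" if y: "y \<in> I +> x" for y
  proof -
    obtain i where i: "i \<in> I" "y = i \<oplus> x"
      using y by (auto simp: a_r_coset_def')
    have "c \<odot>\<^bsub>A\<^esub> y \<in> I +> (c \<odot>\<^bsub>A\<^esub> x)"
      using i assms smult_ideal[OF assms(1,2) i(1)] I.Icarr
      by (auto simp: a_r_coset_def' smult_r_distr)
    then show ?thesis
      using assms by (intro I.a_repr_independence'[symmetric]) simp_all
  qed
  moreover have "I +> x \<noteq> {}"
    using assms I.a_rcos_self by blast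
  ultimately have "(\<Union>y\<in>I +> x. I +> (c \<odot>\<^bsub>A\<^esub> y)) = I +> (c \<odot>\<^bsub>A\<^esub> x)"
    by (intro SUP_eq_const)
  then show ?thesis
    by (simp only: quot_algebra_def module.simps)
qed

lemma (in assoc_algebra) quot_algebra_assoc_algebra:
  assumes "ideal I A"
  shows "assoc_algebra k (quot_algebra A I)"
proof -
  interpret I: ideal I A by fact
  let ?Q = "quot_algebra A I"
  have carr: "carrier ?Q = {I +> x | x. x \<in> carrier A}"
    by (auto simp: quot_algebra_def FactRing_def A_RCOSETS_def')
  have add: "(I +> x) \<oplus>\<^bsub>?Q\<^esub> (I +> y) = I +> (x \<oplus> y)"
    and mult: "(I +> x) \<otimes>\<^bsub>?Q\<^esub> (I +> y) = I +> (x \<otimes> y)"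
    if "x \<in> carrier A" "y \<in> carrier A" for x y
    using that by (auto simp: quot_algebra_def FactRing_def I.a_rcos_sum I.rcoset_mult_add)
  note sm = quot_algebra_smult[OF assms]
  have "ring (A Quot I)" by (rule I.quotient_is_ring)
  then interpret Q: ring "A Quot I" .
  have Q_simps: "carrier ?Q = carrier (A Quot I)" "mult ?Q = mult (A Quot I)"
      "one ?Q = one (A Quot I)" "zero ?Q = zero (A Quot I)" "add ?Q = add (A Quot I)"
    by (simp_all add: quot_algebra_def)
  have "abelian_group ?Q"
  proof (rule abelian_groupI, unfold Q_simps)
    show "\<exists>y\<in>carrier (A Quot I). y \<oplus>\<^bsub>A Quot I\<^esub> x = \<zero>\<^bsub>A Quot I\<^esub>"
      if "x \<in> carrier (A Quot I)" for x
      using Q.l_neg[OF that] Q.a_inv_closed[OF that] by (rule bexI)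
  qed (fact Q.a_closed Q.zero_closed Q.a_assoc Q.a_comm Q.l_zero)+
  moreover have "Group.monoid ?Q"
    by (rule monoidI, unfold Q_simps) (simp_all add: Q.m_assoc)
  ultimately have "ring ?Q"
    by (rule ringI, unfold Q_simps) (simp_all add: Q.l_distr Q.r_distr)
  then interpret Q': ring ?Q .
  have "module k ?Q"
    by (intro module.intro module_axioms.intro module.R.cring_axioms Q'.abelian_group_axioms)
      (auto simp: carr add sm smult_l_distr smult_r_distr smult_assoc1)
  then have "vectorspace k ?Q"
    by (intro vectorspace.intro field_axioms)
  then show ?thesis
    using \<open>ring ?Q\<close>
    by (intro assoc_algebra.intro assoc_algebra_axioms.intro)
      (auto simp: carr mult sm smult_mult_left smult_mult_right)
qed

lemma (in assoc_algebra) natural_epimorphism: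
  assumes "ideal I A"
  shows "(\<lambda>x. I +> x) \<in> alg_hom k A (quot_algebra A I)"
    and "(\<lambda>x. I +> x) ` carrier A = carrier (quot_algebra A I)"
proof -
  interpret I: ideal I A by fact
  show "(\<lambda>x. I +> x) ` carrier A = carrier (quot_algebra A I)"
    by (auto simp: quot_algebra_def FactRing_def A_RCOSETS_def')
  then show "(\<lambda>x. I +> x) \<in> alg_hom k A (quot_algebra A I)"
    by (auto simp: alg_hom_def quot_algebra_smult[OF assms] intro!: ring_hom_memI)
      (auto simp: quot_algebra_def FactRing_def I.a_rcos_sum I.rcoset_mult_add)
qed

text \<open>The zero ideal has to be excluded in statements about non-splitting.\<close>

lemma (in assoc_algebra) natural_epimorphism_zero_splits:
  "\<exists>\<iota>\<in>alg_hom k (quot_algebra A {\<zero>}) A. \<forall>X\<in>carrier (quot_algebra A {\<zero>}). {\<zero>} +> \<iota> X = X"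
proof -
  have id: "ideal {\<zero>} A" by (rule zeroideal)
  have coset: "{\<zero>} +> x = {x}" if "x \<in> carrier A" for x
    using that by (auto simp: a_r_coset_def')
  have hom: "(\<lambda>x. {x}) \<in> alg_hom k A (quot_algebra A {\<zero>})"
    using natural_epimorphism(1)[OF id] by (auto simp: alg_hom_def ring_hom_def coset Pi_iff)
  have carr: "carrier (quot_algebra A {\<zero>}) = (\<lambda>x. {x}) ` carrier A"
    using natural_epimorphism(2)[OF id] coset by auto
  have "the_elem \<in> alg_hom k (quot_algebra A {\<zero>}) A"
    using hom by (auto simp: alg_hom_def carr ring_hom_def Pi_iff; metis the_elem_eq)
  then show ?thesis
    by (rule bexI[rotated]) (auto simp: carr coset)
qed

lemma simple_left_module_transport:
  fixes N :: "('a, 'v, 'm) module_scheme" and \<phi> :: "'v \<Rightarrow> 'w"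
  assumes simple: "simple_left_module R N" and inj: "inj_on \<phi> (carrier N)"
  shows "\<exists>M :: ('a, 'w) module. simple_left_module R M \<and> left_module_iso R N M"
proof -
  interpret left_module R N
    using simple by (simp add: simple_left_module_def)
  define \<psi> where "\<psi> = inv_into (carrier N) \<phi>"
  have \<psi>\<phi> [simp]: "\<psi> (\<phi> v) = v" if "v \<in> carrier N" for v
    using that inj by (simp add: \<psi>_def)
  define M :: "('a, 'w) module" where "M =
    \<lparr>carrier = \<phi> ` carrier N, mult = undefined, one = undefined, zero = \<phi> \<zero>\<^bsub>N\<^esub>,
     add = (\<lambda>x y. \<phi> (\<psi> x \<oplus>\<^bsub>N\<^esub> \<psi> y)), smult = (\<lambda>a x. \<phi> (a \<odot>\<^bsub>N\<^esub> \<psi> x))\<rparr>"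
  have carr: "carrier M = \<phi> ` carrier N" and zero: "\<zero>\<^bsub>M\<^esub> = \<phi> \<zero>\<^bsub>N\<^esub>"
    by (simp_all add: M_def)
  have add [simp]: "\<phi> v \<oplus>\<^bsub>M\<^esub> \<phi> w = \<phi> (v \<oplus>\<^bsub>N\<^esub> w)" if "v \<in> carrier N" "w \<in> carrier N" for v w
    using that by (simp add: M_def)
  have smult [simp]: "a \<odot>\<^bsub>M\<^esub> \<phi> v = \<phi> (a \<odot>\<^bsub>N\<^esub> v)" if "v \<in> carrier N" for a v
    using that by (simp add: M_def)
  have "abelian_group M"
  proof (rule abelian_groupI)
    fix x assume "x \<in> carrier M"
    then obtain v where v: "v \<in> carrier N" "x = \<phi> v" by (auto simp: carr)
    then have "\<phi> (\<ominus>\<^bsub>N\<^esub> v) \<oplus>\<^bsub>M\<^esub> x = \<zero>\<^bsub>M\<^esub>" by (simp add: zero M.l_neg)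
    then show "\<exists>y\<in>carrier M. y \<oplus>\<^bsub>M\<^esub> x = \<zero>\<^bsub>M\<^esub>" using v by (auto simp: carr)
  qed (auto simp: carr zero M.a_ac)
  then have lm: "left_module R M"
    by (intro left_module.intro left_module_axioms.intro R.ring_axioms)
      (auto simp: carr lsmult_l_distr lsmult_r_distr lsmult_assoc1)
  interpret M': left_module R M by (rule lm)
  have "carrier M \<noteq> {\<zero>\<^bsub>M\<^esub>}"
  proof
    assume *: "carrier M = {\<zero>\<^bsub>M\<^esub>}"
    have "v = \<zero>\<^bsub>N\<^esub>" if "v \<in> carrier N" for v
    proof -
      have "\<phi> v = \<phi> \<zero>\<^bsub>N\<^esub>" using * that by (auto simp: carr zero)
      then show ?thesis using inj that by (auto dest: inj_onD)
    qed
    then have "carrier N = {\<zero>\<^bsub>N\<^esub>}" using M.zero_closed by blast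
    then show False using simple by (simp add: simple_left_module_def)
  qed
  moreover have "P = {\<zero>\<^bsub>M\<^esub>} \<or> P = carrier M" if P: "Module.submodule P R M" for P
  proof -
    interpret P: Module.submodule P R M by (rule P)
    define Q where "Q = {v \<in> carrier N. \<phi> v \<in> P}"
    have sub: "P \<subseteq> carrier M" using P.subset by simp
    have PQ: "P = \<phi> ` Q" using sub by (auto simp: Q_def carr)
    have inv: "\<phi> (\<ominus>\<^bsub>N\<^esub> v) \<in> P" if "v \<in> carrier N" "\<phi> v \<in> P" for v
    proof -
      have "\<phi> (\<ominus>\<^bsub>N\<^esub> v) \<oplus>\<^bsub>M\<^esub> \<phi> v = \<zero>\<^bsub>M\<^esub>" using that by (simp add: zero M.l_neg)
      then have "\<ominus>\<^bsub>M\<^esub> (\<phi> v) = \<phi> (\<ominus>\<^bsub>N\<^esub> v)"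
        using that by (intro M'.M.minus_equality) (auto simp: carr)
      then show ?thesis using P.m_inv_closed[OF that(2)] by (simp add: a_inv_def)
    qed
    have "Module.submodule Q R N"
    proof (intro Module.submodule.intro subgroup.intro Module.submodule_axioms.intro)
      show "Q \<subseteq> carrier (add_monoid N)" by (auto simp: Q_def)
      show "\<one>\<^bsub>add_monoid N\<^esub> \<in> Q" using P.one_closed by (simp add: Q_def zero)
      show "v \<otimes>\<^bsub>add_monoid N\<^esub> w \<in> Q" if "v \<in> Q" "w \<in> Q" for v w
        using that P.m_closed[of "\<phi> v" "\<phi> w"] by (simp add: Q_def)
      show "inv\<^bsub>add_monoid N\<^esub> v \<in> Q" if "v \<in> Q" for v
        using that inv[of v] by (simp add: Q_def flip: a_inv_def)
      show "a \<odot>\<^bsub>N\<^esub> v \<in> Q" if "a \<in> carrier R" "v \<in> Q" for a v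
        using that P.smult_closed[of a "\<phi> v"] by (simp add: Q_def)
    qed
    then have "Q = {\<zero>\<^bsub>N\<^esub>} \<or> Q = carrier N"
      using simple by (simp add: simple_left_module_def)
    then show ?thesis by (auto simp: PQ carr zero)
  qed
  ultimately have "simple_left_module R M"
    using lm by (simp add: simple_left_module_def)
  moreover have "\<phi> \<in> module_hom R N M"
    by (auto simp: module_hom_def carr)
  then have "left_module_iso R N M"
    using inj by (auto simp: left_module_iso_def bij_betw_def carr)
  ultimately show ?thesis by blast
qed

theorem simple_left_module_universe:
  fixes R :: "('a, 'b) ring_scheme" and N :: "('a, 'v, 'm) module_scheme"
  assumes simple: "simple_left_module R N"
  shows "\<exists>M :: ('a, 'a set) module. simple_left_module R M \<and> left_module_iso R N M"
proof -
  interpret left_module R N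
    using simple by (simp add: simple_left_module_def)
  obtain n where n: "n \<in> carrier N" "n \<noteq> \<zero>\<^bsub>N\<^esub>"
    using simple M.zero_closed by (auto simp: simple_left_module_def)
  let ?Q = "(\<lambda>a. a \<odot>\<^bsub>N\<^esub> n) ` carrier R"
  have null: "\<zero>\<^bsub>R\<^esub> \<odot>\<^bsub>N\<^esub> n = \<zero>\<^bsub>N\<^esub>"
  proof -
    have "\<zero>\<^bsub>R\<^esub> \<odot>\<^bsub>N\<^esub> n \<oplus>\<^bsub>N\<^esub> \<zero>\<^bsub>R\<^esub> \<odot>\<^bsub>N\<^esub> n = \<zero>\<^bsub>R\<^esub> \<odot>\<^bsub>N\<^esub> n"
      using n lsmult_l_distr[of "\<zero>\<^bsub>R\<^esub>" "\<zero>\<^bsub>R\<^esub>" n] by simp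
    then show ?thesis using n by (simp add: M.add.l_cancel_one)
  qed
  have neg: "\<ominus>\<^bsub>N\<^esub> (a \<odot>\<^bsub>N\<^esub> n) = (\<ominus>\<^bsub>R\<^esub> a) \<odot>\<^bsub>N\<^esub> n" if "a \<in> carrier R" for a
    using that n null lsmult_l_distr[of "\<ominus>\<^bsub>R\<^esub> a" a n]
    by (intro M.minus_equality) (auto simp: R.l_neg)
  have "Module.submodule ?Q R N"
  proof (intro Module.submodule.intro subgroup.intro Module.submodule_axioms.intro)
    show "?Q \<subseteq> carrier (add_monoid N)" using n by auto
    show "\<one>\<^bsub>add_monoid N\<^esub> \<in> ?Q" 
      using null by (intro image_eqI[of _ _ "\<zero>\<^bsub>R\<^esub>"]) simp_all
    show "v \<otimes>\<^bsub>add_monoid N\<^esub> w \<in> ?Q" if "v \<in> ?Q" "w \<in> ?Q" for v w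
      using that n by (force simp flip: lsmult_l_distr)
    show "inv\<^bsub>add_monoid N\<^esub> v \<in> ?Q" if "v \<in> ?Q" for v
      using that neg by (auto simp flip: a_inv_def)
    show "a \<odot>\<^bsub>N\<^esub> v \<in> ?Q" if "a \<in> carrier R" "v \<in> ?Q" for a v
      using that n by (auto simp flip: lsmult_assoc1)
  qed
  moreover have "n \<in> ?Q" using n by (intro image_eqI[of _ _ "\<one>\<^bsub>R\<^esub>"]) auto
  ultimately have Q: "?Q = carrier N"
    using simple n(2) unfolding simple_left_module_def by blast
  have "inj_on (\<lambda>v. {a \<in> carrier R. a \<odot>\<^bsub>N\<^esub> n = v}) (carrier N)"
  proof (rule inj_onI)
    fix v w
    assume v: "v \<in> carrier N" and
      eq: "{a \<in> carrier R. a \<odot>\<^bsub>N\<^esub> n = v} = {a \<in> carrier R. a \<odot>\<^bsub>N\<^esub> n = w}"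
    have "v \<in> ?Q" unfolding Q by (rule v)
    then obtain a where "v = a \<odot>\<^bsub>N\<^esub> n" "a \<in> carrier R" by (rule imageE)
    then have "a \<in> {a \<in> carrier R. a \<odot>\<^bsub>N\<^esub> n = v}" by simp
    then have "a \<in> {a \<in> carrier R. a \<odot>\<^bsub>N\<^esub> n = w}" unfolding eq .
    then show "v = w" using \<open>v = a \<odot>\<^bsub>N\<^esub> n\<close> by simp
  qed
  with simple show ?thesis by (rule simple_left_module_transport)
qed

end

theory Submission
  imports Defs
begin

text \<open>Let \<open>S\<close> be the image of a splitting, so that \<open>\<Lambda> = S \<oplus> K\<close>. For \<open>a, b \<in> J\<close> write
  \<open>a = s + u\<close> and \<open>b = t + v\<close> with \<open>s, t \<in> S\<close> and \<open>u, v \<in> K\<close>; then \<open>ab = st + (sv + ub)\<close>, and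
  \<open>sv + ub \<in> JK + KJ\<close>. Hence \<open>K \<subseteq> J\<^sup>2 \<subseteq> S + (JK + KJ)\<close>, and \<open>S \<inter> K = 0\<close> gives \<open>K = JK + KJ\<close>.
  So \<open>K \<subseteq> J\<^sup>n\<close> implies \<open>K \<subseteq> J\<^sup>n\<^sup>+\<^sup>1\<close>, and \<open>K = 0\<close> because \<open>J\<close> is nilpotent.\<close>

section \<open>Chain conditions in finite dimensional spaces\<close>

context vectorspace
begin

text \<open>For a subspace of a finite dimensional space this is its dimension, computed from
  independent sets of \<open>V\<close> itself, so that no vector space structure on \<open>W\<close>
  has to be formed.\<close>

definition subspace_rank :: "'c set \<Rightarrow> nat"
  where "subspace_rank W = Max (card ` {B. B \<subseteq> W \<and> lin_indpt B})"

context
  fixes W :: "'c set"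
  assumes fd: fin_dim and W: "W \<subseteq> carrier V"
begin

lemma finite_card_lin_indpt: "finite (card ` {B. B \<subseteq> W \<and> lin_indpt B})"
  using W li_le_dim(2)[OF fd] by (intro finite_subset[OF _ finite_atMost[of dim]]) blast

lemma subspace_rank_ge: "B \<subseteq> W \<Longrightarrow> lin_indpt B \<Longrightarrow> card B \<le> subspace_rank W"
  unfolding subspace_rank_def by (intro Max_ge finite_card_lin_indpt) blast

lemma subspace_rank_attained:
  obtains B where "B \<subseteq> W" "lin_indpt B" "finite B" "card B = subspace_rank W"
proof -
  \<comment> \<open>The empty set is independent, so the maximum is taken over a nonempty
    set.\<close>
  have "{B. B \<subseteq> W \<and> lin_indpt B} \<noteq> {}"
    by (auto simp: lin_dep_def)
  then have "subspace_rank W \<in> card ` {B. B \<subseteq> W \<and> lin_indpt B}"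
    unfolding subspace_rank_def by (intro Max_in finite_card_lin_indpt) blast
  then obtain B where "B \<subseteq> W" "lin_indpt B" "card B = subspace_rank W"
    by auto
  then show ?thesis
    using that[of B] fin_dim_li_fin[OF fd, of B] W by auto
qed

lemma subspace_rank_le_dim: "subspace_rank W \<le> dim"
proof -
  obtain B where "B \<subseteq> W" "lin_indpt B" "card B = subspace_rank W"
    by (rule subspace_rank_attained)
  then show ?thesis
    using li_le_dim(2)[OF fd, of B] W by auto
qed

end

text \<open>A largest independent set in \<open>W\<close> has its span inside \<open>W\<close>, so
  any vector of \<open>U - W\<close> extends it to a larger independent set in
  \<open>U\<close>.\<close>

lemma subspace_rank_strict_mono:
  assumes fd: fin_dim and sub: "LinearCombinations.submodule K W V"
    and "W \<subset> U" "U \<subseteq> carrier V"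
  shows "subspace_rank W < subspace_rank U"
proof -
  have W: "W \<subseteq> carrier V"
    using assms by blast
  obtain B where B: "B \<subseteq> W" "lin_indpt B" "finite B" "card B = subspace_rank W"
    by (rule subspace_rank_attained[OF fd W])
  obtain v where v: "v \<in> U" "v \<notin> W"
    using assms by blast
  have "v \<notin> span B"
    using span_is_subset[OF B(1) sub] v by blast
  moreover have "v \<notin> B" "B \<subseteq> carrier V" "v \<in> carrier V"
    using B v W assms by auto
  ultimately have "lin_indpt (B \<union> {v})"
    using lin_dep_iff_in_span[of B v] B(2) by blast
  then have "card (B \<union> {v}) \<le> subspace_rank U"
    using B v assms by (intro subspace_rank_ge[OF fd]) auto
  then show ?thesis
    using B \<open>v \<notin> B\<close> by simp
qed

end

section \<open>Left ideals and the radical\<close>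

context ring
begin

text \<open>The submodule is taken in \<open>left_regular R\<close>, whose additive group is that of
  \<open>R\<close>; this form allows working with the operations of \<open>R\<close> alone.\<close>

lemma left_ideal_iff:
  "left_ideal I R \<longleftrightarrow> additive_subgroup I R \<and> (\<forall>a\<in>carrier R. \<forall>x\<in>I. a \<otimes> x \<in> I)"
proof -
  have "subgroup I (add_monoid (left_regular R)) \<longleftrightarrow> subgroup I (add_monoid R)"
    by (simp add: subgroup_def m_inv_def left_regular_def)
  then show ?thesis
    by (auto simp: Module.submodule_def Module.submodule_axioms_def additive_subgroup_def
        left_regular_def)
qed

lemma left_idealI:
  assumes "I \<subseteq> carrier R" "\<zero> \<in> I" "\<And>x y. x \<in> I \<Longrightarrow> y \<in> I \<Longrightarrow> x \<oplus> y \<in> I"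
    "\<And>a x. a \<in> carrier R \<Longrightarrow> x \<in> I \<Longrightarrow> a \<otimes> x \<in> I"
  shows "left_ideal I R"
proof -
  \<comment> \<open>Negatives come for free, being multiples by
    \<open>\<ominus> \<one>\<close>.\<close>
  have "\<ominus> x \<in> I" if "x \<in> I" for x
    using assms(4)[of "\<ominus> \<one>" x] that assms(1) by (auto simp: l_minus)
  then show ?thesis
    unfolding left_ideal_iff additive_subgroup_def using assms
    by (auto intro!: subgroup.intro simp: a_inv_def[symmetric])
qed

lemma left_idealD:
  assumes "left_ideal I R"
  shows "I \<subseteq> carrier R" "\<zero> \<in> I"
    "x \<in> I \<Longrightarrow> y \<in> I \<Longrightarrow> x \<oplus> y \<in> I" "x \<in> I \<Longrightarrow> \<ominus> x \<in> I"
    "a \<in> carrier R \<Longrightarrow> x \<in> I \<Longrightarrow> a \<otimes> x \<in> I"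
proof -
  interpret I: additive_subgroup I R
    using assms by (simp add: left_ideal_iff)
  show "I \<subseteq> carrier R" "\<zero> \<in> I" "x \<in> I \<Longrightarrow> y \<in> I \<Longrightarrow> x \<oplus> y \<in> I" "x \<in> I \<Longrightarrow> \<ominus> x \<in> I"
    using I.a_subset by auto
  show "a \<in> carrier R \<Longrightarrow> x \<in> I \<Longrightarrow> a \<otimes> x \<in> I"
    using assms by (simp add: left_ideal_iff)
qed

lemma left_ideal_ideal: "ideal I R \<Longrightarrow> left_ideal I R"
  unfolding left_ideal_iff by (auto simp: ideal_def ideal.I_l_closed)

text \<open>This is \<open>M + Rx\<close>, the left ideal against which the maximality of
  \<open>M\<close> is tested below.\<close>

lemma left_ideal_sum_principal:
  assumes M: "left_ideal M R" and x: "x \<in> carrier R"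
  shows "left_ideal {m \<oplus> a \<otimes> x | m a. m \<in> M \<and> a \<in> carrier R} R" (is "left_ideal ?S R")
proof (rule left_idealI)
  note M = left_idealD[OF M]
  show "?S \<subseteq> carrier R"
    using M x by auto
  show "\<zero> \<in> ?S"
    using M x by (intro CollectI exI[of _ \<zero>]) auto
  show "y \<oplus> z \<in> ?S" if yz: "y \<in> ?S" "z \<in> ?S" for y z
  proof -
    from yz obtain m a n b where *: "y = m \<oplus> a \<otimes> x" "z = n \<oplus> b \<otimes> x"
      "m \<in> M" "n \<in> M" "a \<in> carrier R" "b \<in> carrier R" by blast
    moreover have "m \<in> carrier R" "n \<in> carrier R"
      using * M by auto
    ultimately have "y \<oplus> z = (m \<oplus> n) \<oplus> (a \<oplus> b) \<otimes> x"
      using x by (simp add: l_distr a_ac)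
    then show ?thesis
      using * M by blast
  qed
  show "b \<otimes> y \<in> ?S" if b: "b \<in> carrier R" and y: "y \<in> ?S" for b y
  proof -
    from y obtain m a where *: "y = m \<oplus> a \<otimes> x" "m \<in> M" "a \<in> carrier R"
      by blast
    then have "b \<otimes> y = b \<otimes> m \<oplus> (b \<otimes> a) \<otimes> x"
      using M(1) b x by (auto simp: r_distr m_assoc)
    then show ?thesis
      using * M b by blast
  qed
qed

lemma left_ideal_colon:
  assumes M: "left_ideal M R" and x: "x \<in> carrier R"
  shows "left_ideal {a \<in> carrier R. a \<otimes> x \<in> M} R"
  using left_idealD[OF M] x by (intro left_idealI) (auto simp: l_distr m_assoc)

text \<open>For \<open>x \<in> N - M\<close> the left ideal \<open>{a. a x \<in> M}\<close> is the annihilator of a generator of the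
  simple module \<open>N/M\<close>, hence maximal.\<close>

lemma jacobson_radical_mult_maximal:
  assumes N: "left_ideal N R" and M: "left_ideal M R" and "M \<subseteq> N"
    and max: "\<And>L. left_ideal L R \<Longrightarrow> M \<subseteq> L \<Longrightarrow> L \<subseteq> N \<Longrightarrow> L = M \<or> L = N"
    and j: "j \<in> jacobson_radical R" and x: "x \<in> N"
  shows "j \<otimes> x \<in> M"
proof (cases "x \<in> M")
  case True
  then show ?thesis
    using left_idealD(5)[OF M] j by (auto simp: jacobson_radical_def)
next
  case False
  note Mc = left_idealD[OF M] and Nc = left_idealD[OF N]
  have xR: "x \<in> carrier R"
    using x Nc by blast
  define C where "C = {a \<in> carrier R. a \<otimes> x \<in> M}"
  have C: "left_ideal C R"
    unfolding C_def by (rule left_ideal_colon[OF M xR])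
  have "\<one> \<notin> C"
    using False xR by (simp add: C_def)
  have "L = C \<or> L = carrier R" if L: "left_ideal L R" "C \<subseteq> L" for L
  proof (rule disjCI)
    note Lc = left_idealD[OF L(1)]
    assume "L \<noteq> carrier R"
    show "L = C"
    proof (rule ccontr)
      assume "L \<noteq> C"
      then obtain z where z: "z \<in> L" "z \<notin> C" using L by blast
      have zR: "z \<in> carrier R" using z Lc by blast
      then have zx: "z \<otimes> x \<notin> M" "z \<otimes> x \<in> N" "z \<otimes> x \<in> carrier R"
        using z x xR Nc by (auto simp: C_def)
      \<comment> \<open>Since \<open>z \<otimes> x\<close> lies in \<open>N\<close> but not in
        \<open>M\<close>, maximality forces \<open>M + Rzx = N\<close>, so
        \<open>x = m + azx\<close>. Then \<open>1 - az\<close> lies in \<open>C\<close>, hence in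
        \<open>L\<close>, and so does \<open>az\<close>; thus \<open>L\<close> contains
        \<open>\<one>\<close>.\<close>
      let ?S = "{m \<oplus> a \<otimes> (z \<otimes> x) | m a. m \<in> M \<and> a \<in> carrier R}"
      have "\<exists>m a. y = m \<oplus> a \<otimes> (z \<otimes> x) \<and> m \<in> M \<and> a \<in> carrier R" if "y \<in> M" for y
        using that zx Mc by (intro exI[of _ y] exI[of _ \<zero>]) auto
      then have "M \<subseteq> ?S" by blast
      moreover have "?S \<subseteq> N" using zx \<open>M \<subseteq> N\<close> Nc by auto
      moreover have "\<exists>m a. z \<otimes> x = m \<oplus> a \<otimes> (z \<otimes> x) \<and> m \<in> M \<and> a \<in> carrier R"
        using zx Mc by (intro exI[of _ \<zero>] exI[of _ \<one>]) auto
      ultimately have "?S = N"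
        using max[OF left_ideal_sum_principal[OF M zx(3)]] zx by blast
      then obtain m a where ma: "x = m \<oplus> a \<otimes> (z \<otimes> x)" "m \<in> M" "a \<in> carrier R"
        using x by blast
      have mR: "m \<in> carrier R" using ma Mc by blast
      have "(\<one> \<ominus> a \<otimes> z) \<otimes> x = x \<ominus> a \<otimes> (z \<otimes> x)"
        using ma zR xR by (simp add: minus_eq l_distr l_minus m_assoc)
      also have "\<dots> = m"
      proof -
        have "(m \<oplus> w) \<ominus> w = m" if "w \<in> carrier R" for w
          using that mR by (simp add: minus_eq a_assoc r_neg)
        from this[of "a \<otimes> (z \<otimes> x)"] show ?thesis
          using ma zx by simp
      qed
      finally have "\<one> \<ominus> a \<otimes> z \<in> L"
        using ma zR L by (auto simp: C_def)
      then have "(\<one> \<ominus> a \<otimes> z) \<oplus> a \<otimes> z \<in> L"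
        using Lc ma z by blast
      then have "\<one> \<in> L"
        using ma zR by (simp add: minus_eq a_assoc l_neg)
      then have "c \<in> L" if "c \<in> carrier R" for c
        using Lc(5)[of c \<one>] that by simp
      then show False
        using \<open>L \<noteq> carrier R\<close> Lc by blast
    qed
  qed
  then have "maximal_left_ideal C R"
    using C \<open>\<one> \<notin> C\<close> by (auto simp: maximal_left_ideal_def)
  then show ?thesis
    using j by (auto simp: jacobson_radical_def C_def)
qed

section \<open>The Jacobson radical as a two-sided ideal\<close>

lemma left_ideal_carrier: "left_ideal (carrier R) R"
  by (intro left_idealI) auto

lemma jacobson_radical_left_ideal: "left_ideal (jacobson_radical R) R"
proof (rule left_idealI)
  have M: "left_ideal M R" if "maximal_left_ideal M R" for M
    using that by (simp add: maximal_left_ideal_def)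
  show "jacobson_radical R \<subseteq> carrier R" "\<zero> \<in> jacobson_radical R"
    using left_idealD(2)[OF M] by (auto simp: jacobson_radical_def)
  show "x \<oplus> y \<in> jacobson_radical R" if "x \<in> jacobson_radical R" "y \<in> jacobson_radical R" for x y
    using that left_idealD(3)[OF M] by (auto simp: jacobson_radical_def)
  show "a \<otimes> x \<in> jacobson_radical R" if "a \<in> carrier R" "x \<in> jacobson_radical R" for a x
    using that left_idealD(5)[OF M] by (auto simp: jacobson_radical_def)
qed

text \<open>Only closure under right multiplication needs an argument: the radical annihilates
  \<open>R/M\<close> for each maximal left ideal \<open>M\<close>, which is the previous criterion
  with \<open>N\<close> the whole ring.\<close>

lemma jacobson_radical_ideal: "ideal (jacobson_radical R) R"
proof (rule idealI)
  show "subgroup (jacobson_radical R) (add_monoid R)"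
    using jacobson_radical_left_ideal by (simp add: left_ideal_iff additive_subgroup_def)
  show "x \<otimes> a \<in> jacobson_radical R" if "a \<in> jacobson_radical R" "x \<in> carrier R" for a x
    using that left_idealD(5)[OF jacobson_radical_left_ideal] by blast
  show "a \<otimes> x \<in> jacobson_radical R" if "a \<in> jacobson_radical R" "x \<in> carrier R" for a x
  proof -
    have "a \<otimes> x \<in> M" if M: "maximal_left_ideal M R" for M
      using M \<open>a \<in> _\<close> \<open>x \<in> _\<close> left_idealD(1)[of M]
      by (intro jacobson_radical_mult_maximal[OF left_ideal_carrier])
        (auto simp: maximal_left_ideal_def)
    then show ?thesis
      using that by (auto simp: jacobson_radical_def)
  qed
qed (rule ring_axioms)

text \<open>\<open>(ideal_prod R I ^^ n) I\<close> is the ideal power \<open>I\<^sup>n\<^sup>+\<^sup>1\<close>.\<close>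

lemma ideal_power_ideal:
  assumes "ideal I R"
  shows "ideal ((ideal_prod R I ^^ n) I) R"
  using assms by (induction n) (auto intro: ideal_prod_is_ideal)

text \<open>The iteration multiplies by \<open>I\<close> on the left; products with \<open>I\<close>
  on the right have to be recognised as the same power.\<close>

lemma ideal_power_commute:
  assumes "ideal I R"
  shows "ideal_prod R ((ideal_prod R I ^^ n) I) I = (ideal_prod R I ^^ Suc n) I"
  using assms by (induction n) (simp_all add: ideal_prod_assoc ideal_power_ideal)

text \<open>Each induction step raises by one the power of \<open>I\<close> known to contain
  \<open>K\<close>. The iterate with index 0 is \<open>I\<close> itself, so the base case is
  \<open>K \<subseteq> I\<close>.\<close>

lemma complement_in_radical_power:
  assumes I: "ideal I R" and K: "ideal K R" "K \<subseteq> ideal_prod R I I"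
    and S: "S \<subseteq> carrier R" "\<And>s t. s \<in> S \<Longrightarrow> t \<in> S \<Longrightarrow> s \<oplus> t \<in> S"
      "\<And>s t. s \<in> S \<Longrightarrow> t \<in> S \<Longrightarrow> s \<otimes> t \<in> S" "S \<inter> K \<subseteq> {\<zero>}"
    and dec: "\<And>a. a \<in> carrier R \<Longrightarrow> \<exists>s\<in>S. \<exists>u\<in>K. a = s \<oplus> u"
  shows "K \<subseteq> (ideal_prod R I ^^ n) I"
proof (induction n)
  case 0
  show ?case
    using K ideal_prod_inter[OF I I] by auto
next
  case (Suc n)
  interpret I: ideal I R by (rule I)
  interpret K: ideal K R by (rule K)
  have KI: "K \<subseteq> I"
    using K ideal_prod_inter[OF I I] by auto
  define P where "P = (ideal_prod R I ^^ n) I"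
  define Q where "Q = (ideal_prod R I ^^ Suc n) I"
  interpret Q: ideal Q R unfolding Q_def by (rule ideal_power_ideal[OF I])
  have Q1: "Q = ideal_prod R I P" and Q2: "Q = ideal_prod R P I"
    using ideal_power_commute[OF I, of n] by (simp_all add: P_def Q_def)
  \<comment> \<open>The remainder \<open>w\<close> is kept in both ideals: membership in
    \<open>Q\<close> is the goal, and membership in \<open>K\<close> later forces the
    \<open>S\<close>-part of an element of \<open>K\<close> to vanish.\<close>
  have *: "\<exists>s\<in>S. \<exists>w\<in>K \<inter> Q. x = s \<oplus> w" if "x \<in> ideal_prod R I I" for x
    using that
  proof (induction x rule: ideal_prod.induct)
    case (prod a b)
    obtain s u where su: "s \<in> S" "u \<in> K" "a = s \<oplus> u"
      using dec prod I.Icarr by blast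
    obtain t v where tv: "t \<in> S" "v \<in> K" "b = t \<oplus> v"
      using dec prod I.Icarr by blast
    have carr: "s \<in> carrier R" "u \<in> carrier R" "t \<in> carrier R" "v \<in> carrier R"
      using su tv S K.Icarr by auto
    \<comment> \<open>The \<open>S\<close>-part of an element of \<open>I\<close> stays in
      \<open>I\<close> because \<open>K \<subseteq> I\<close>.\<close>
    have "a \<ominus> u \<in> I"
      unfolding minus_eq using prod su KI by blast
    moreover have "a \<ominus> u = s"
      using su carr by (simp add: minus_eq a_assoc r_neg)
    ultimately have sI: "s \<in> I"
      by simp
    \<comment> \<open>By the induction hypothesis \<open>v\<close> and \<open>u\<close> lie in
      \<open>P\<close>, so the two mixed terms lie in \<open>IP\<close> and \<open>PI\<close>, which
      are both \<open>Q\<close>.\<close>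
    have "s \<otimes> v \<in> Q"
      unfolding Q1 using sI tv Suc by (auto intro: ideal_prod.prod simp: P_def)
    moreover have "u \<otimes> b \<in> Q"
      unfolding Q2 using prod su Suc by (auto intro: ideal_prod.prod simp: P_def)
    moreover have "s \<otimes> v \<in> K" "u \<otimes> b \<in> K"
      using su tv carr prod I.Icarr by (auto intro: K.I_l_closed K.I_r_closed)
    ultimately have "s \<otimes> v \<oplus> u \<otimes> b \<in> K \<inter> Q"
      by auto
    moreover have "a \<otimes> b = s \<otimes> t \<oplus> (s \<otimes> v \<oplus> u \<otimes> b)"
      using carr by (simp add: su(3) tv(3) l_distr r_distr a_ac)
    ultimately show ?case
      using S su tv by blast
  next
    case (sum x y)
    then obtain s w t z where *: "s \<in> S" "w \<in> K \<inter> Q" "x = s \<oplus> w" "t \<in> S" "z \<in> K \<inter> Q" "y = t \<oplus> z"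
      by blast
    then have "s \<in> carrier R" "w \<in> carrier R" "t \<in> carrier R" "z \<in> carrier R"
      using S K.Icarr by auto
    then have "x \<oplus> y = (s \<oplus> t) \<oplus> (w \<oplus> z)"
      using * by (simp add: a_ac)
    then show ?case
      using * S by (metis IntE IntI K.a_closed Q.a_closed)
  qed
  show ?case
  proof
    fix x assume x: "x \<in> K"
    then obtain s w where sw: "s \<in> S" "w \<in> K" "w \<in> Q" "x = s \<oplus> w"
      using * K by blast
    have carr: "s \<in> carrier R" "w \<in> carrier R" using sw S K.Icarr by auto
    have "x \<ominus> w \<in> K"
      unfolding minus_eq using x sw by blast
    moreover have "x \<ominus> w = s"
      using sw carr by (simp add: minus_eq a_assoc r_neg)
    ultimately have "s \<in> K"
      by simp
    then have "s = \<zero>"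
      using sw S by blast
    then show "x \<in> (ideal_prod R I ^^ Suc n) I"
      using sw carr by (simp add: Q_def)
  qed
qed

end

section \<open>Finite dimensional algebras\<close>

context assoc_algebra
begin

text \<open>A scalar \<open>c\<close> acts as left multiplication by \<open>c\<close> times the
  unit, so left ideals are subspaces and their chains are controlled by
  \<open>subspace_rank\<close>.\<close>

lemma left_ideal_submodule:
  assumes I: "left_ideal I A"
  shows "LinearCombinations.submodule k I A"
proof -
  note Ic = left_idealD[OF I]
  have "c \<odot>\<^bsub>A\<^esub> x \<in> I" if "c \<in> carrier k" "x \<in> I" for c x
  proof -
    have "c \<odot>\<^bsub>A\<^esub> x = (c \<odot>\<^bsub>A\<^esub> \<one>) \<otimes> x"
      using that Ic by (auto simp: smult_mult_left)
    then show ?thesis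
      using that Ic(5) by simp
  qed
  then show ?thesis
    using Ic module_axioms by (auto simp: LinearCombinations.submodule_def)
qed

lemma left_ideal_rank_less:
  assumes "fin_dim" "left_ideal I A" "left_ideal L A" "I \<subset> L"
  shows "subspace_rank I < subspace_rank L"
  using assms left_ideal_submodule left_idealD(1)[of L] by (intro subspace_rank_strict_mono) auto

text \<open>If \<open>N\<close> were nonzero, a proper left subideal \<open>M\<close> of greatest
  rank would be maximal in \<open>N\<close>. The radical annihilates the simple module
  \<open>N/M\<close>, so \<open>JN \<subseteq> M\<close>, against
  \<open>N \<subseteq> JN\<close>.\<close>

lemma nakayama:
  assumes fd: fin_dim and N: "left_ideal N A"
    and NJ: "N \<subseteq> ideal_prod A (jacobson_radical A) N"
  shows "N = {\<zero>}"
proof (rule ccontr)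
  assume "N \<noteq> {\<zero>}"
  have z: "left_ideal {\<zero>} A"
    by (intro left_idealI) auto
  define \<M> where "\<M> = {M. left_ideal M A \<and> M \<subset> N}"
  have "{\<zero>} \<in> \<M>"
    using z \<open>N \<noteq> {\<zero>}\<close> left_idealD(2)[OF N] by (auto simp: \<M>_def)
  moreover have "subspace_rank M < Suc dim" if "M \<in> \<M>" for M
    using that subspace_rank_le_dim[OF fd] left_idealD(1)[of M] by (auto simp: \<M>_def less_Suc_eq_le)
  ultimately obtain M where M: "M \<in> \<M>" "\<And>L. L \<in> \<M> \<Longrightarrow> subspace_rank L \<le> subspace_rank M"
    using ex_has_greatest_nat[of "\<lambda>M. M \<in> \<M>" "{\<zero>}" subspace_rank "Suc dim"] by auto
  then have MN: "left_ideal M A" "M \<subset> N"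
    by (auto simp: \<M>_def)
  have "L = M \<or> L = N" if "left_ideal L A" "M \<subseteq> L" "L \<subseteq> N" for L
  proof (rule disjCI)
    assume "L \<noteq> N"
    then have "subspace_rank L \<le> subspace_rank M"
      using that by (intro M(2)) (auto simp: \<M>_def)
    then show "L = M"
      using left_ideal_rank_less[OF fd MN(1) that(1)] that(2) by fastforce
  qed
  then have jx: "j \<otimes> x \<in> M" if "j \<in> jacobson_radical A" "x \<in> N" for j x
    using jacobson_radical_mult_maximal[OF N MN(1)] MN(2) that by blast
  have "y \<in> M" if "y \<in> ideal_prod A (jacobson_radical A) N" for y
    using that by induction (auto intro: jx left_idealD(3)[OF MN(1)])
  then show False
    using NJ MN by blast
qed

text \<open>The powers of the radical decrease, so one of least rank equals its successor, and
  Nakayama makes it zero.\<close>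

lemma jacobson_radical_nilpotent:
  assumes fd: fin_dim
  shows "\<exists>n. (ideal_prod A (jacobson_radical A) ^^ n) (jacobson_radical A) = {\<zero>}"
proof -
  let ?J = "jacobson_radical A"
  let ?P = "\<lambda>n. (ideal_prod A ?J ^^ n) ?J"
  note J = jacobson_radical_ideal
  have P: "left_ideal (?P n) A" for n
    by (rule left_ideal_ideal[OF ideal_power_ideal[OF J]])
  obtain n where n: "\<And>m. subspace_rank (?P n) \<le> subspace_rank (?P m)"
    using ex_has_least_nat[of "\<lambda>_. True" 0 "\<lambda>n. subspace_rank (?P n)"] by auto
  have "?P (Suc n) \<subseteq> ?P n"
    using ideal_prod_inter[OF J ideal_power_ideal[OF J]] by auto
  then have "?P (Suc n) = ?P n"
    using left_ideal_rank_less[OF fd P[of "Suc n"] P[of n]] n[of "Suc n"] by fastforce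
  then show ?thesis
    using nakayama[OF fd P[of n]] by auto
qed

end

section \<open>Non-splitting of the natural epimorphism\<close>

text \<open>The ideal \<open>K\<close> is taken nonzero because the epimorphism modulo the zero
  ideal is an isomorphism and therefore splits.\<close>

theorem corollary5p6:
  fixes k :: "('c, 'd) ring_scheme"
    and \<Lambda> :: "('c, 'a, 'm) module_scheme"
    and K :: "'a set"
  assumes "assoc_algebra k \<Lambda>"
    and "vectorspace.fin_dim k \<Lambda>"
    and "basic_algebra \<Lambda>"
    and "one_dimensional_simples k \<Lambda>"
    and "ideal K \<Lambda>"
    and "K \<subseteq> ideal_prod \<Lambda> (jacobson_radical \<Lambda>) (jacobson_radical \<Lambda>)"
    and "K \<noteq> {\<zero>\<^bsub>\<Lambda>\<^esub>}"
  shows "\<not> (\<exists>\<iota>\<in>alg_hom k (quot_algebra \<Lambda> K) \<Lambda>.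
    \<forall>X\<in>carrier (quot_algebra \<Lambda> K). K +>\<^bsub>\<Lambda>\<^esub> \<iota> X = X)"
proof
  interpret \<Lambda>: assoc_algebra k \<Lambda> by fact
  interpret K: ideal K \<Lambda> by fact
  let ?Q = "quot_algebra \<Lambda> K"
  interpret Q: assoc_algebra k ?Q
    by (rule \<Lambda>.quot_algebra_assoc_algebra) fact
  assume "\<exists>\<iota>\<in>alg_hom k ?Q \<Lambda>. \<forall>X\<in>carrier ?Q. K +>\<^bsub>\<Lambda>\<^esub> \<iota> X = X"
  then obtain \<iota> where hom: "\<iota> \<in> ring_hom ?Q \<Lambda>"
    and split: "\<And>X. X \<in> carrier ?Q \<Longrightarrow> K +>\<^bsub>\<Lambda>\<^esub> \<iota> X = X"
    by (auto simp: alg_hom_def)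
  interpret \<iota>: ring_hom_ring ?Q \<Lambda> \<iota>
    by (intro ring_hom_ringI2 Q.ring_axioms \<Lambda>.ring_axioms hom)
  let ?S = "\<iota> ` carrier ?Q"
  have "?S \<inter> K \<subseteq> {\<zero>\<^bsub>\<Lambda>\<^esub>}"
  proof
    fix x assume "x \<in> ?S \<inter> K"
    then obtain X where X: "X \<in> carrier ?Q" "x = \<iota> X" "x \<in> K" by blast
    \<comment> \<open>The coset of \<open>\<iota> X\<close> is \<open>X\<close> by the splitting,
      and it is \<open>K\<close> because \<open>\<iota> X\<close> lies in \<open>K\<close>; so
      \<open>X\<close> is the zero of the quotient.\<close>
    then have "X = K"
      using split[of X] \<Lambda>.a_coset_join2[OF _ K.a_subgroup] K.Icarr by auto
    moreover have "K = \<zero>\<^bsub>?Q\<^esub>"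
      by (simp add: quot_algebra_def FactRing_def)
    ultimately show "x \<in> {\<zero>\<^bsub>\<Lambda>\<^esub>}"
      using X \<iota>.hom_zero by simp
  qed
  moreover have "\<exists>s\<in>?S. \<exists>u\<in>K. a = s \<oplus>\<^bsub>\<Lambda>\<^esub> u" if a: "a \<in> carrier \<Lambda>" for a
  proof -
    \<comment> \<open>The \<open>S\<close>-part of \<open>a\<close> is the image under
      \<open>\<iota>\<close> of its own coset: both lie in that coset, so they differ by an element
      of \<open>K\<close>.\<close>
    define X where "X = K +>\<^bsub>\<Lambda>\<^esub> a"
    have X: "X \<in> carrier ?Q"
      using a \<Lambda>.natural_epimorphism(2)[OF K.ideal_axioms] by (auto simp: X_def)
    have "a \<in> K +>\<^bsub>\<Lambda>\<^esub> \<iota> X"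
      using split[OF X] K.a_rcos_self[OF a] by (simp add: X_def)
    then obtain u where u: "u \<in> K" "a = u \<oplus>\<^bsub>\<Lambda>\<^esub> \<iota> X"
      by (auto simp: a_r_coset_def')
    then have "a = \<iota> X \<oplus>\<^bsub>\<Lambda>\<^esub> u"
      using X K.Icarr \<Lambda>.a_comm by simp
    then show ?thesis
      using X u by blast
  qed
  ultimately have "K \<subseteq> (ideal_prod \<Lambda> (jacobson_radical \<Lambda>) ^^ n) (jacobson_radical \<Lambda>)" for n
    using assms(5,6)
    by (intro \<Lambda>.complement_in_radical_power[OF \<Lambda>.jacobson_radical_ideal, where S = ?S])
      (auto simp flip: \<iota>.hom_add \<iota>.hom_mult)
  then have "K \<subseteq> {\<zero>\<^bsub>\<Lambda>\<^esub>}"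
    using \<Lambda>.jacobson_radical_nilpotent[OF assms(2)] by metis
  then show False
    using assms(7) K.zero_closed by blast
qed

end
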